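(* Let $k,\ell$ be nonnegative integers such that $p := k+\ell-1$ is a positive integer. Then there exist no nonzero self-similar solutions $$U_1(x,t) = \frac{1}{(1-t)^{\frac{1}{2p}}}\, U\!\left(\frac{x}{1-t}\right), \qquad U_2(x,t) = \frac{1}{(1-t)^{\frac{1}{2p}}}\, V\!\left(\frac{x}{1-t}\right)$$ of the nonlinear Dirac system $$i(\partial_t U_1 + \partial_x U_1) = \partial_{\bar U_1} W(U_1,U_2,\bar U_1,\bar U_2), \qquad i(\partial_t U_2 - \partial_x U_2) = \partial_{\bar U_2} W(U_1,U_2,\bar U_1,\bar U_2)$$ with potential $$W = (|U_1|^2+|U_2|^2)^k(\bar U_1 U_2 + \bar U_2 U_1)^{\ell}$$ whose profiles satisfy $(U,V) \in C^1(-1,1)\cap L^\infty([-1,1])$. Equivalently, there is no pair $(U,V)\neq(0,0)$ of complex-valued functions in $C^1(-1,1)\cap L^\infty([-1,1])$ satisfying, for all $y\in(-1,1)$, $$i\Big[(y+1)U' + \tfrac{1}{2p}U\Big] = FV + GU, \qquad i\Big[(y-1)V' + \tfrac{1}{2p}V\Big] = FU + GV,$$ where $$F = \ell\,(|U|^2+|V|^2)^k (U\bar V + \bar U V)^{\ell-1}, \qquad G = k\,(|U|^2+|V|^2)^{k-1}(U\bar V + \bar U V)^{\ell}.$$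
   Context: Here $\bar U$ denotes the complex conjugate of $U$; $U_1,U_2$ are complex-valued; $\partial_{\bar U_j}W$ is the derivative of the polynomial $W$ with respect to $\bar U_j$, treating $U_1,U_2,\bar U_1,\bar U_2$ as independent variables (so $|U_j|^2 = U_j\bar U_j$). The profiles $U,V$ are functions of the self-similar variable $y = x/(1-t)$, $t<1$, which is restricted to the interval $[-1,1]$, and the prime denotes $d/dy$. The displayed ODE system results from substituting the self-similar form into the Dirac system. By convention $F\equiv 0$ if $\ell=0$ and $G\equiv 0$ if $k=0$; zeroth powers equal $1$. *)

theory Defs
  imports "HOL-Analysis.Analysis"
begin

text \<open>The polynomial \<open>W\<close>, with \<open>w1\<close>, \<open>w2\<close> in place of the conjugates of \<open>u1\<close>, \<open>u2\<close>, so that all four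
  arguments are independent complex variables.\<close>

definition dirac_W :: "nat \<Rightarrow> nat \<Rightarrow> complex \<Rightarrow> complex \<Rightarrow> complex \<Rightarrow> complex \<Rightarrow> complex" where
  "dirac_W k l u1 u2 w1 w2 = (u1 * w1 + u2 * w2) ^ k * (w1 * u2 + w2 * u1) ^ l"

definition dW_cnj1 :: "nat \<Rightarrow> nat \<Rightarrow> complex \<Rightarrow> complex \<Rightarrow> complex" where
  "dW_cnj1 k l u1 u2 = deriv (\<lambda>w. dirac_W k l u1 u2 w (cnj u2)) (cnj u1)"

definition dW_cnj2 :: "nat \<Rightarrow> nat \<Rightarrow> complex \<Rightarrow> complex \<Rightarrow> complex" where
  "dW_cnj2 k l u1 u2 = deriv (\<lambda>w. dirac_W k l u1 u2 (cnj u1) w) (cnj u2)"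

text \<open>Fields are functions of \<open>x\<close> and \<open>t\<close>, in this order; elements of \<open>S\<close> are pairs \<open>(x, t)\<close>.\<close>

definition dirac_solution_on ::
  "nat \<Rightarrow> nat \<Rightarrow> (real \<times> real) set \<Rightarrow> (real \<Rightarrow> real \<Rightarrow> complex) \<Rightarrow> (real \<Rightarrow> real \<Rightarrow> complex) \<Rightarrow> bool" where
  "dirac_solution_on k l S U1 U2 \<longleftrightarrow>
     (\<forall>(x, t) \<in> S. \<exists>U1t U1x U2t U2x.
        ((\<lambda>s. U1 x s) has_vector_derivative U1t) (at t) \<and>
        ((\<lambda>z. U1 z t) has_vector_derivative U1x) (at x) \<and>
        ((\<lambda>s. U2 x s) has_vector_derivative U2t) (at t) \<and>
        ((\<lambda>z. U2 z t) has_vector_derivative U2x) (at x) \<and>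
        \<i> * (U1t + U1x) = dW_cnj1 k l (U1 x t) (U2 x t) \<and>
        \<i> * (U2t - U2x) = dW_cnj2 k l (U1 x t) (U2 x t))"

definition self_similar :: "nat \<Rightarrow> (real \<Rightarrow> complex) \<Rightarrow> real \<Rightarrow> real \<Rightarrow> complex" where
  "self_similar p U x t = of_real (1 / (1 - t) powr (1 / (2 * real p))) * U (x / (1 - t))"

text \<open>The points with \<open>t < 1\<close> at which \<open>y = x / (1 - t)\<close> lies in the open interval \<open>(-1, 1)\<close>.\<close>

definition light_cone :: "(real \<times> real) set" where
  "light_cone = {(x, t). t < 1 \<and> x / (1 - t) \<in> {-1<..<1}}"

definition L_infinity_on :: "real set \<Rightarrow> (real \<Rightarrow> complex) \<Rightarrow> bool" where
  "L_infinity_on S f \<longleftrightarrow> f \<in> borel_measurable (lebesgue_on S) \<and>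
     (\<exists>C. AE y in lebesgue_on S. cmod (f y) \<le> C)"

definition admissible_profile :: "(real \<Rightarrow> complex) \<Rightarrow> bool" where
  "admissible_profile U \<longleftrightarrow> U C1_differentiable_on {-1<..<1} \<and> L_infinity_on {-1..1} U"

text \<open>For \<open>l = 0\<close> (resp. \<open>k = 0\<close>) the exponent \<open>l - 1\<close> (resp. \<open>k - 1\<close>) truncates to \<open>0\<close>, but the
  factor \<open>of_nat l\<close> (resp. \<open>of_nat k\<close>) makes the expression vanish, as intended.\<close>

definition dirac_F :: "nat \<Rightarrow> nat \<Rightarrow> complex \<Rightarrow> complex \<Rightarrow> complex" where
  "dirac_F k l u v = of_nat l * of_real ((cmod u)\<^sup>2 + (cmod v)\<^sup>2) ^ k * (u * cnj v + cnj u * v) ^ (l - 1)"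

definition dirac_G :: "nat \<Rightarrow> nat \<Rightarrow> complex \<Rightarrow> complex \<Rightarrow> complex" where
  "dirac_G k l u v = of_nat k * of_real ((cmod u)\<^sup>2 + (cmod v)\<^sup>2) ^ (k - 1) * (u * cnj v + cnj u * v) ^ l"

definition profile_ode :: "nat \<Rightarrow> nat \<Rightarrow> nat \<Rightarrow> (real \<Rightarrow> complex) \<Rightarrow> (real \<Rightarrow> complex) \<Rightarrow> bool" where
  "profile_ode k l p U V \<longleftrightarrow>
     (\<forall>y \<in> {-1<..<1}.
        \<i> * (of_real (y + 1) * vector_derivative U (at y) + of_real (1 / (2 * real p)) * U y)
          = dirac_F k l (U y) (V y) * V y + dirac_G k l (U y) (V y) * U y \<and>
        \<i> * (of_real (y - 1) * vector_derivative V (at y) + of_real (1 / (2 * real p)) * V y)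
          = dirac_F k l (U y) (V y) * U y + dirac_G k l (U y) (V y) * V y)"

end

theory Submission
  imports Defs
begin

text \<open>
  Write \<open>a = 1 / (2 * p)\<close>, \<open>A = |U|\<^sup>2\<close>, \<open>B = |V|\<^sup>2\<close> and let \<open>N\<close> and \<open>M\<close> be twice the real and the
  imaginary part of \<open>cnj U * V\<close>. These four real functions satisfy a closed system
  (\<open>A_deriv\<close>, \<open>B_deriv\<close>, \<open>N_deriv\<close>, \<open>M_deriv\<close>), with singular points at \<open>y = -1\<close> and \<open>y = 1\<close>.
  Each step of the proof finds a quantity of the form \<open>g y * (1 + y)\<^sup>c * (1 - y)\<^sup>d\<close> that is monotone,
  with \<open>g\<close> bounded. At an endpoint where the weight vanishes the quantity tends to zero, which
  fixes its sign on the whole interval.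

  The key quantity is the potential \<open>W = (A + B)\<^sup>k * N\<^sup>l\<close>. In its derivative the terms with \<open>M\<close> cancel,
  because the system is Hamiltonian up to the scaling terms, and what is left is bounded by a
  multiple of \<open>W\<close> itself. Near \<open>y = 1\<close> a nonzero \<open>W\<close> would therefore have to grow at least like
  \<open>(1 - y)\<close> to the power \<open>- a * l\<close>, which boundedness of the profile excludes if \<open>l > 0\<close>. Hence
  \<open>W = 0\<close> (\<open>W_eq_0\<close>), and so \<open>N = 0\<close> (\<open>N_eq_0\<close>).

  If \<open>l \<noteq> 1\<close>, the coefficient \<open>F\<close> coupling the two equations now vanishes: it carries the factor
  \<open>l * N ^ (l - 1)\<close>. The coefficient \<open>G\<close> only rotates phases, so \<open>A * (1 + y) powr (2 * a)\<close> and
  \<open>B * (1 - y) powr (2 * a)\<close> are constant, and these constants are zero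
  (\<open>profile_eq_0_decoupled\<close>). If \<open>l = 1\<close>, then \<open>F = (A + B)\<^sup>k\<close> may be nonzero, but then
  \<open>M\<close> times \<open>(1 - y\<^sup>2) powr a\<close> is nondecreasing and tends to zero at both endpoints. So it is constant,
  and its derivative vanishes only where \<open>U = V = 0\<close> (\<open>profile_eq_0_l_eq_1\<close>).

  A self-similar solution of the Dirac system gives a solution of the profile equations by
  restriction to the line \<open>t = 0\<close>, where \<open>y = x\<close> (\<open>profile_ode_if_dirac_solution\<close>).
\<close>

section \<open>Monotone functions on the interval\<close>

lemma nonpos_if_nondecreasing_tendsto_0_left:
  fixes f :: "real \<Rightarrow> real"
  assumes deriv: "\<And>y. y \<in> {a<..<b} \<Longrightarrow> (f has_real_derivative f' y) (at y)"
    and nonneg: "\<And>y. y \<in> {a<..<b} \<Longrightarrow> f' y \<ge> 0"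
    and lim: "(f \<longlongrightarrow> 0) (at_left b)" and x: "x \<in> {a<..<b}"
  shows "f x \<le> 0"
proof (rule tendsto_lowerbound[OF lim])
  have "f x \<le> f z" if "z \<in> {x<..<b}" for z
  proof (rule DERIV_nonneg_imp_nondecreasing[of x z f])
    show "x \<le> z" using that by simp
    show "\<exists>d. DERIV f t :> d \<and> d \<ge> 0" if "x \<le> t" "t \<le> z" for t
      using deriv[of t] nonneg[of t] that x \<open>z \<in> {x<..<b}\<close> by auto
  qed
  then show "\<forall>\<^sub>F z in at_left b. f x \<le> f z"
    using x by (auto intro!: eventually_at_leftI[of x])
qed simp

lemma nonneg_if_nondecreasing_tendsto_0_right:
  fixes f :: "real \<Rightarrow> real"
  assumes deriv: "\<And>y. y \<in> {a<..<b} \<Longrightarrow> (f has_real_derivative f' y) (at y)"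
    and nonneg: "\<And>y. y \<in> {a<..<b} \<Longrightarrow> f' y \<ge> 0"
    and lim: "(f \<longlongrightarrow> 0) (at_right a)" and x: "x \<in> {a<..<b}"
  shows "f x \<ge> 0"
proof (rule tendsto_upperbound[OF lim])
  have "f z \<le> f x" if "z \<in> {a<..<x}" for z
  proof (rule DERIV_nonneg_imp_nondecreasing[of z x f])
    show "z \<le> x" using that by simp
    show "\<exists>d. DERIV f t :> d \<and> d \<ge> 0" if "z \<le> t" "t \<le> x" for t
      using deriv[of t] nonneg[of t] that x \<open>z \<in> {a<..<x}\<close> by auto
  qed
  then show "\<forall>\<^sub>F z in at_right a. f z \<le> f x"
    using x by (auto intro!: eventually_at_rightI[of _ x])
qed simp

lemma bounded_times_powr_tendsto_0_at_left_1:
  fixes g :: "real \<Rightarrow> real"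
  assumes "\<And>y. y \<in> {-1<..<1} \<Longrightarrow> \<bar>g y\<bar> \<le> K" and "0 \<le> c" and "0 < d"
  shows "((\<lambda>y. g y * (1 + y) powr c * (1 - y) powr d) \<longlongrightarrow> 0) (at_left 1)"
proof (rule Lim_null_comparison)
  have "((\<lambda>y::real. K * 2 powr c * (1 - y) powr d) \<longlongrightarrow> K * 2 powr c * (1 - 1) powr d) (at_left 1)"
    using \<open>0 < d\<close>
    by (intro tendsto_intros) (auto intro!: eventually_at_leftI[of 0])
  then show "((\<lambda>y::real. K * 2 powr c * (1 - y) powr d) \<longlongrightarrow> 0) (at_left 1)" by simp
  have "norm (g y * (1 + y) powr c * (1 - y) powr d) \<le> K * 2 powr c * (1 - y) powr d"
    if y: "y \<in> {0<..<1}" for y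
  proof -
    have "\<bar>g y\<bar> * (1 + y) powr c \<le> K * 2 powr c"
      using assms(1)[of y] y \<open>0 \<le> c\<close> by (intro mult_mono powr_mono2) auto
    then show ?thesis
      by (simp add: abs_mult mult_right_mono)
  qed
  then show "\<forall>\<^sub>F y in at_left 1. norm (g y * (1 + y) powr c * (1 - y) powr d) \<le> K * 2 powr c * (1 - y) powr d"
    by (auto intro!: eventually_at_leftI[of 0])
qed

text \<open>The reflection \<open>y \<mapsto> - y\<close> exchanges the two endpoints and the two exponents.\<close>

lemma bounded_times_powr_tendsto_0_at_right_m1:
  fixes g :: "real \<Rightarrow> real"
  assumes "\<And>y. y \<in> {-1<..<1} \<Longrightarrow> \<bar>g y\<bar> \<le> K" and "0 < c" and "0 \<le> d"
  shows "((\<lambda>y. g y * (1 + y) powr c * (1 - y) powr d) \<longlongrightarrow> 0) (at_right (-1))"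
proof -
  have "((\<lambda>y. g (- y) * (1 + y) powr d * (1 - y) powr c) \<longlongrightarrow> 0) (at_left 1)"
    using assms by (intro bounded_times_powr_tendsto_0_at_left_1[of _ K]) auto
  then show ?thesis
    unfolding at_right_minus filterlim_filtermap by (simp add: mult_ac)
qed

text \<open>The equations below can be brought to the form \<open>(1 - y\<^sup>2) * f' = D\<close>. A weight \<open>(1 + y)\<^sup>c * (1 - y)\<^sup>d\<close> adds
  \<open>((c - d) - (c + d) * y) * f\<close> to \<open>D\<close>: the sum of the exponents serves to remove a term
  proportional to \<open>y * f\<close>, their difference to add a multiple of \<open>f\<close>.\<close>

lemma weighted_deriv:
  fixes f :: "real \<Rightarrow> real"
  assumes y: "y \<in> {-1<..<1}" and f: "(f has_real_derivative D / ((1 + y) * (1 - y))) (at y)"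
  shows "((\<lambda>y. f y * (1 + y) powr c * (1 - y) powr d) has_real_derivative
           (D + (c * (1 - y) - d * (1 + y)) * f y) * (1 + y) powr (c - 1) * (1 - y) powr (d - 1)) (at y)"
proof -
  have pos: "1 + y > 0" "1 - y > 0" using y by auto
  have eq: "(1 + y) powr c = (1 + y) * (1 + y) powr (c - 1)"
    "(1 - y) powr d = (1 - y) * (1 - y) powr (d - 1)"
    using pos by (simp_all add: powr_mult_base)
  have cancel: "D / (u * v) * (u * P) * (v * Q) = D * P * Q" if "u > 0" "v > 0" for u v P Q :: real
    using that by simp
  have "((\<lambda>y. f y * (1 + y) powr c * (1 - y) powr d) has_real_derivative
        D / ((1 + y) * (1 - y)) * (1 + y) powr c * (1 - y) powr d
        + f y * (c * (1 + y) powr (c - 1)) * (1 - y) powr d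
        - f y * (1 + y) powr c * (d * (1 - y) powr (d - 1))) (at y)"
    using pos by (auto intro!: derivative_eq_intros f simp: algebra_simps)
  also have "D / ((1 + y) * (1 - y)) * (1 + y) powr c * (1 - y) powr d
        + f y * (c * (1 + y) powr (c - 1)) * (1 - y) powr d
        - f y * (1 + y) powr c * (d * (1 - y) powr (d - 1))
      = D * (1 + y) powr (c - 1) * (1 - y) powr (d - 1)
        + f y * (c * (1 + y) powr (c - 1)) * ((1 - y) * (1 - y) powr (d - 1))
        - f y * ((1 + y) * (1 + y) powr (c - 1)) * (d * (1 - y) powr (d - 1))"
    unfolding eq using cancel pos by simp
  also have "\<dots> = (D + (c * (1 - y) - d * (1 + y)) * f y) * (1 + y) powr (c - 1) * (1 - y) powr (d - 1)"
    by (simp add: algebra_simps)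
  finally show ?thesis .
qed

text \<open>The set where the bound fails is open in the interval and Lebesgue negligible, hence empty.\<close>

lemma ae_bounded_continuous_imp_bounded:
  fixes f :: "real \<Rightarrow> complex"
  assumes cont: "continuous_on {-1<..<1} f" and bound: "AE y in lebesgue_on {-1..1}. cmod (f y) \<le> C"
    and y: "y \<in> {-1<..<1}"
  shows "cmod (f y) \<le> C"
proof (rule ccontr)
  let ?E = "{z \<in> {-1<..<1}. C < cmod (f z)}"
  assume "\<not> cmod (f y) \<le> C"
  then have "y \<in> ?E" using y by auto
  have "openin (top_of_set {-1<..<1}) ({-1<..<1} \<inter> (\<lambda>z. cmod (f z)) -` {C<..})"
    by (intro continuous_openin_preimage_gen continuous_intros cont)
  moreover have "{-1<..<1} \<inter> (\<lambda>z. cmod (f z)) -` {C<..} = ?E" by auto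
  ultimately have "open ?E" 
    using openin_open_eq[of "{-1<..<1::real}"] by auto
  have "AE z in lebesgue. z \<in> {-1..1} \<longrightarrow> cmod (f z) \<le> C"
    using bound by (subst (asm) AE_restrict_space_iff) auto
  then obtain T where "T \<in> null_sets lebesgue" "{z. \<not> (z \<in> {-1..1} \<longrightarrow> cmod (f z) \<le> C)} \<subseteq> T"
    unfolding eventually_ae_filter by auto
  then have "negligible T" "?E \<subseteq> T" by (auto simp: negligible_iff_null_sets)
  then have "negligible ?E" using negligible_subset by blast
  then show False
    using open_not_negligible[OF \<open>open ?E\<close>] \<open>y \<in> ?E\<close> by blast
qed

section \<open>Real quadratic quantities of a profile\<close>

locale bounded_dirac_profile =
  fixes k l :: nat and a C :: real and U V U' V' :: "real \<Rightarrow> complex"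
  assumes a_pos: "a > 0"
    and U_deriv: "\<And>y. y \<in> {-1<..<1} \<Longrightarrow> (U has_vector_derivative U' y) (at y)"
    and V_deriv: "\<And>y. y \<in> {-1<..<1} \<Longrightarrow> (V has_vector_derivative V' y) (at y)"
    and U_ode: "\<And>y. y \<in> {-1<..<1} \<Longrightarrow> \<i> * (of_real (y + 1) * U' y + of_real a * U y)
          = dirac_F k l (U y) (V y) * V y + dirac_G k l (U y) (V y) * U y"
    and V_ode: "\<And>y. y \<in> {-1<..<1} \<Longrightarrow> \<i> * (of_real (y - 1) * V' y + of_real a * V y)
          = dirac_F k l (U y) (V y) * U y + dirac_G k l (U y) (V y) * V y"
    and U_bound: "\<And>y. y \<in> {-1<..<1} \<Longrightarrow> cmod (U y) \<le> C"
    and V_bound: "\<And>y. y \<in> {-1<..<1} \<Longrightarrow> cmod (V y) \<le> C"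
begin

definition A :: "real \<Rightarrow> real" where "A y = (cmod (U y))\<^sup>2"
definition B :: "real \<Rightarrow> real" where "B y = (cmod (V y))\<^sup>2"
definition N :: "real \<Rightarrow> real" where "N y = 2 * Re (cnj (U y) * V y)"
definition M :: "real \<Rightarrow> real" where "M y = 2 * Im (cnj (U y) * V y)"
text \<open>\<open>F\<close> and \<open>G\<close> are the partial derivatives of \<open>W\<close> with respect to \<open>N\<close> and to \<open>A + B\<close>.\<close>

definition F :: "real \<Rightarrow> real" where "F y = l * (A y + B y) ^ k * N y ^ (l - 1)"
definition G :: "real \<Rightarrow> real" where "G y = k * (A y + B y) ^ (k - 1) * N y ^ l"
definition W :: "real \<Rightarrow> real" where "W y = (A y + B y) ^ k * N y ^ l"

lemma A_nonneg: "A y \<ge> 0" and B_nonneg: "B y \<ge> 0"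
  by (simp_all add: A_def B_def)

lemma A_eq: "A y = Re (U y) * Re (U y) + Im (U y) * Im (U y)"
  and B_eq: "B y = Re (V y) * Re (V y) + Im (V y) * Im (V y)"
  unfolding A_def B_def cmod_power2 by (simp_all add: power2_eq_square)

lemma dirac_F_eq: "dirac_F k l (U y) (V y) = of_real (F y)"
  and dirac_G_eq: "dirac_G k l (U y) (V y) = of_real (G y)"
proof -
  have "U y * cnj (V y) + cnj (U y) * V y = of_real (N y)"
    by (simp add: N_def complex_eq_iff)
  then show "dirac_F k l (U y) (V y) = of_real (F y)" "dirac_G k l (U y) (V y) = of_real (G y)"
    by (simp_all add: dirac_F_def dirac_G_def F_def G_def A_def B_def)
qed

text \<open>As \<open>F\<close> and \<open>G\<close> are real, the profile equations split into real and imaginary parts, solved here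
  for the derivatives.\<close>

lemma
  assumes y: "y \<in> {-1<..<1}"
  shows ReU_deriv: "((\<lambda>y. Re (U y)) has_real_derivative
            (F y * Im (V y) + G y * Im (U y) - a * Re (U y)) / (1 + y)) (at y)"
    and ImU_deriv: "((\<lambda>y. Im (U y)) has_real_derivative
            (- F y * Re (V y) - G y * Re (U y) - a * Im (U y)) / (1 + y)) (at y)"
    and ReV_deriv: "((\<lambda>y. Re (V y)) has_real_derivative
            (a * Re (V y) - F y * Im (U y) - G y * Im (V y)) / (1 - y)) (at y)"
    and ImV_deriv: "((\<lambda>y. Im (V y)) has_real_derivative
            (a * Im (V y) + F y * Re (U y) + G y * Re (V y)) / (1 - y)) (at y)"
proof -
  have nz: "1 + y \<noteq> 0" "1 - y \<noteq> 0" using y by auto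
  have "(1 + y) * Re (U' y) = F y * Im (V y) + G y * Im (U y) - a * Re (U y)"
    "(1 + y) * Im (U' y) = - F y * Re (V y) - G y * Re (U y) - a * Im (U y)"
    using arg_cong[OF U_ode[OF y], of Im] arg_cong[OF U_ode[OF y], of Re]
    by (simp_all add: dirac_F_eq dirac_G_eq algebra_simps)
  then have "Re (U' y) = (F y * Im (V y) + G y * Im (U y) - a * Re (U y)) / (1 + y)"
    "Im (U' y) = (- F y * Re (V y) - G y * Re (U y) - a * Im (U y)) / (1 + y)"
    using nz by (simp_all add: eq_divide_eq mult.commute)
  with U_deriv[OF y]
  show "((\<lambda>y. Re (U y)) has_real_derivative
            (F y * Im (V y) + G y * Im (U y) - a * Re (U y)) / (1 + y)) (at y)"
    "((\<lambda>y. Im (U y)) has_real_derivative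
            (- F y * Re (V y) - G y * Re (U y) - a * Im (U y)) / (1 + y)) (at y)"
    unfolding has_real_derivative_iff_has_vector_derivative
    using bounded_linear.has_vector_derivative[OF bounded_linear_Re, of U "U' y" "at y"]
      bounded_linear.has_vector_derivative[OF bounded_linear_Im, of U "U' y" "at y"]
    by simp_all
  have "(1 - y) * Re (V' y) = a * Re (V y) - F y * Im (U y) - G y * Im (V y)"
    "(1 - y) * Im (V' y) = a * Im (V y) + F y * Re (U y) + G y * Re (V y)"
    using arg_cong[OF V_ode[OF y], of Im] arg_cong[OF V_ode[OF y], of Re]
    by (simp_all add: dirac_F_eq dirac_G_eq algebra_simps)
  then have "Re (V' y) = (a * Re (V y) - F y * Im (U y) - G y * Im (V y)) / (1 - y)"
    "Im (V' y) = (a * Im (V y) + F y * Re (U y) + G y * Re (V y)) / (1 - y)"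
    using nz by (simp_all add: eq_divide_eq mult.commute)
  with V_deriv[OF y]
  show "((\<lambda>y. Re (V y)) has_real_derivative
            (a * Re (V y) - F y * Im (U y) - G y * Im (V y)) / (1 - y)) (at y)"
    "((\<lambda>y. Im (V y)) has_real_derivative
            (a * Im (V y) + F y * Re (U y) + G y * Re (V y)) / (1 - y)) (at y)"
    unfolding has_real_derivative_iff_has_vector_derivative
    using bounded_linear.has_vector_derivative[OF bounded_linear_Re, of V "V' y" "at y"]
      bounded_linear.has_vector_derivative[OF bounded_linear_Im, of V "V' y" "at y"]
    by simp_all
qed

text \<open>The \<open>G\<close>-terms drop out of the equations for \<open>A\<close> and \<open>B\<close>, since multiplying \<open>U\<close> or \<open>V\<close> by a
  phase does not change its modulus.\<close>

lemma A_deriv: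
  assumes y: "y \<in> {-1<..<1}"
  shows "(A has_real_derivative
    (F y * M y - 2 * a * A y) / (1 + y)) (at y)"
proof -
  have nz: "1 + y \<noteq> 0" "1 - y \<noteq> 0" using y by auto
  have eq: "A = (\<lambda>y. Re (U y) * Re (U y) + Im (U y) * Im (U y))"
    by (simp add: A_eq fun_eq_iff)
  show ?thesis
    unfolding eq
    by (rule DERIV_cong[OF DERIV_add[OF DERIV_mult[OF ReU_deriv[OF y] ReU_deriv[OF y]]
        DERIV_mult[OF ImU_deriv[OF y] ImU_deriv[OF y]]]])
      (use nz in \<open>simp add: M_def A_eq divide_simps\<close>,
       simp add: algebra_simps)
qed

lemma B_deriv:
  assumes y: "y \<in> {-1<..<1}"
  shows "(B has_real_derivative
    (F y * M y + 2 * a * B y) / (1 - y)) (at y)"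
proof -
  have nz: "1 + y \<noteq> 0" "1 - y \<noteq> 0" using y by auto
  have eq: "B = (\<lambda>y. Re (V y) * Re (V y) + Im (V y) * Im (V y))"
    by (simp add: B_eq fun_eq_iff)
  show ?thesis
    unfolding eq
    by (rule DERIV_cong[OF DERIV_add[OF DERIV_mult[OF ReV_deriv[OF y] ReV_deriv[OF y]]
        DERIV_mult[OF ImV_deriv[OF y] ImV_deriv[OF y]]]])
      (use nz in \<open>simp add: M_def B_eq divide_simps\<close>,
       simp add: algebra_simps)
qed

lemma N_deriv:
  assumes y: "y \<in> {-1<..<1}"
  shows "(N has_real_derivative
    (2 * a * y * N y - 2 * G y * M y) / ((1 + y) * (1 - y))) (at y)"
proof -
  have nz: "1 + y \<noteq> 0" "1 - y \<noteq> 0" using y by auto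
  have eq: "N = (\<lambda>y. 2 * (Re (U y) * Re (V y) + Im (U y) * Im (V y)))"
    by (simp add: N_def fun_eq_iff)
  show ?thesis
    unfolding eq
    by (rule DERIV_cong[OF DERIV_cmult[OF DERIV_add[OF DERIV_mult[OF ReU_deriv[OF y] ReV_deriv[OF y]]
        DERIV_mult[OF ImU_deriv[OF y] ImV_deriv[OF y]]]]])
      (use nz in \<open>simp add: M_def N_def divide_simps\<close>,
       simp add: algebra_simps)
qed

lemma M_deriv:
  assumes y: "y \<in> {-1<..<1}"
  shows "(M has_real_derivative
    (2 * F y * ((1 + y) * A y + (1 - y) * B y) + 2 * G y * N y + 2 * a * y * M y)
      / ((1 + y) * (1 - y))) (at y)"
proof -
  have nz: "1 + y \<noteq> 0" "1 - y \<noteq> 0" using y by auto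
  have eq: "M = (\<lambda>y. 2 * (Re (U y) * Im (V y) - Im (U y) * Re (V y)))"
    by (simp add: M_def fun_eq_iff)
  show ?thesis
    unfolding eq
    by (rule DERIV_cong[OF DERIV_cmult[OF DERIV_diff[OF DERIV_mult[OF ReU_deriv[OF y] ImV_deriv[OF y]]
        DERIV_mult[OF ImU_deriv[OF y] ReV_deriv[OF y]]]]])
      (use nz in \<open>simp add: M_def N_def A_eq B_eq divide_simps\<close>,
       simp add: algebra_simps)
qed

lemma A_bound: "y \<in> {-1<..<1} \<Longrightarrow> A y \<le> C\<^sup>2"
  and B_bound: "y \<in> {-1<..<1} \<Longrightarrow> B y \<le> C\<^sup>2"
  using U_bound V_bound by (auto simp: A_def B_def intro!: power_mono)

lemma N_bound: "y \<in> {-1<..<1} \<Longrightarrow> \<bar>N y\<bar> \<le> 2 * C\<^sup>2"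
  and M_bound: "y \<in> {-1<..<1} \<Longrightarrow> \<bar>M y\<bar> \<le> 2 * C\<^sup>2"
proof -
  assume y: "y \<in> {-1<..<1}"
  have "cmod (cnj (U y) * V y) \<le> C * C"
    unfolding norm_mult using U_bound[OF y] V_bound[OF y] order_trans[OF norm_ge_zero U_bound[OF y]]
    by (intro mult_mono) auto
  then show "\<bar>N y\<bar> \<le> 2 * C\<^sup>2" "\<bar>M y\<bar> \<le> 2 * C\<^sup>2"
    using abs_Re_le_cmod[of "cnj (U y) * V y"] abs_Im_le_cmod[of "cnj (U y) * V y"]
    unfolding N_def M_def power2_eq_square by linarith+
qed

section \<open>Vanishing of the potential\<close>

text \<open>By the chain rule \<open>W' = G * (A + B)' + F * N'\<close>. The contribution \<open>2 * F * M\<close> of \<open>(A + B)'\<close> and the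
  contribution \<open>- 2 * G * M\<close> of \<open>N'\<close> cancel, and the scaling terms in \<open>y\<close> combine to a multiple of
  \<open>W\<close> by homogeneity.\<close>

lemma W_deriv:
  assumes y: "y \<in> {-1<..<1}"
  shows "(W has_real_derivative
     (2 * a * G y * (B y - A y) + 2 * a * y * (k + l) * W y) / ((1 + y) * (1 - y))) (at y)"
proof -
  have nz: "1 + y \<noteq> 0" "1 - y \<noteq> 0" using y by auto
  have GS: "G y * (A y + B y) = k * W y" and FN: "F y * N y = l * W y"
    unfolding G_def F_def W_def by (cases k; simp)(cases l; simp)
  have chain: "(W has_real_derivative G y * (A' + B') + F y * N') (at y)"
    if "(A has_real_derivative A') (at y)" "(B has_real_derivative B') (at y)"
      "(N has_real_derivative N') (at y)" for A' B' N'
    unfolding W_def[abs_def] F_def G_def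
    by (rule DERIV_cong[OF DERIV_mult[OF DERIV_power[OF DERIV_add[OF that(1,2)]] DERIV_power[OF that(3)]]])
      (simp add: algebra_simps)
  note chain[OF A_deriv[OF y] B_deriv[OF y] N_deriv[OF y]]
  also have "G y * ((F y * M y - 2 * a * A y) / (1 + y) + (F y * M y + 2 * a * B y) / (1 - y))
      + F y * ((2 * a * y * N y - 2 * G y * M y) / ((1 + y) * (1 - y)))
      = (2 * a * G y * (B y - A y) + 2 * a * y * (G y * (A y + B y) + F y * N y)) / ((1 + y) * (1 - y))"
    using nz by (simp add: divide_simps) (simp add: algebra_simps)
  finally show ?thesis
    unfolding GS FN by (simp add: algebra_simps)
qed

text \<open>The square of \<open>W\<close>, multiplied by a suitable weight, is nondecreasing and tends to zero at
  \<open>y = 1\<close>.\<close>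

lemma W_eq_0:
  assumes "l > 0" and y: "y \<in> {-1<..<1}"
  shows "W y = 0"
proof -
  \<comment> \<open>The sum \<open>c + d = 4 * a * (k + l)\<close> removes the scaling term of \<open>W\<^sup>2\<close>, and the difference
    \<open>c - d = 4 * a * k\<close> turns \<open>G * W * (B - A)\<close> into \<open>2 * G * W * B\<close>, which is nonnegative. Here
    \<open>l > 0\<close> makes \<open>d\<close> positive, so that the weight vanishes at \<open>y = 1\<close>.\<close>
  define c d where "c = 2 * a * (2 * k + l)" and "d = 2 * a * l"
  define f where "f y = (W y)\<^sup>2 * (1 + y) powr c * (1 - y) powr d" for y
  have cd: "c \<ge> 0" "d > 0" using a_pos \<open>l > 0\<close> by (auto simp: c_def d_def)
  have GS: "G y * (A y + B y) = k * W y" for y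
    unfolding G_def W_def by (cases k) simp_all
  have GW: "G y * W y \<ge> 0" for y
  proof -
    have "G y * W y = k * (A y + B y) ^ (k - 1) * (A y + B y) ^ k * (N y ^ l)\<^sup>2"
      by (simp add: G_def W_def power2_eq_square)
    then show ?thesis using A_nonneg B_nonneg by simp
  qed
  have "f y \<le> 0"
  proof (rule nonpos_if_nondecreasing_tendsto_0_left[OF _ _ _ y])
    fix z :: real assume z: "z \<in> {-1<..<1}"
    have "((\<lambda>y. (W y)\<^sup>2) has_real_derivative
        (2 * W z * (2 * a * G z * (B z - A z) + 2 * a * z * (k + l) * W z)) / ((1 + z) * (1 - z))) (at z)"
      by (auto intro!: derivative_eq_intros W_deriv[OF z])
    note weighted_deriv[OF z this, of c d]
    moreover have "2 * W z * (2 * a * G z * (B z - A z) + 2 * a * z * (k + l) * W z)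
        + (c * (1 - z) - d * (1 + z)) * (W z)\<^sup>2 = 4 * a * (G z * W z * (B z - A z) + (k * W z) * W z)"
      by (simp add: c_def d_def power2_eq_square algebra_simps)
    moreover have "\<dots> = 8 * a * (G z * W z) * B z"
      unfolding GS[symmetric] by (simp add: algebra_simps)
    ultimately show "(f has_real_derivative
        8 * a * (G z * W z) * B z * (1 + z) powr (c - 1) * (1 - z) powr (d - 1)) (at z)"
      unfolding f_def by simp
    show "8 * a * (G z * W z) * B z * (1 + z) powr (c - 1) * (1 - z) powr (d - 1) \<ge> 0"
      using a_pos GW B_nonneg by simp
  next
    have "\<bar>(W z)\<^sup>2\<bar> \<le> ((2 * C\<^sup>2) ^ k * (2 * C\<^sup>2) ^ l)\<^sup>2" if z: "z \<in> {-1<..<1}" for z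
    proof -
      have "\<bar>W z\<bar> \<le> (2 * C\<^sup>2) ^ k * (2 * C\<^sup>2) ^ l"
        unfolding W_def abs_mult power_abs
        using A_bound[OF z] B_bound[OF z] N_bound[OF z] A_nonneg[of z] B_nonneg[of z]
        by (intro mult_mono power_mono) auto
      then show ?thesis using power_mono[of "\<bar>W z\<bar>" _ 2] by simp
    qed
    then show "(f \<longlongrightarrow> 0) (at_left 1)"
      unfolding f_def using cd by (intro bounded_times_powr_tendsto_0_at_left_1)
  qed
  moreover have "(1 + y) powr c > 0" "(1 - y) powr d > 0" using y by auto
  ultimately have "(W y)\<^sup>2 \<le> 0"
    unfolding f_def by (simp add: mult_le_0_iff not_le[symmetric])
  then show ?thesis by simp
qed

text \<open>Where \<open>A + B\<close> vanishes, so does \<open>N\<close>; elsewhere \<open>W = 0\<close> forces \<open>N = 0\<close>.\<close>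

lemma N_eq_0:
  assumes "l > 0" and y: "y \<in> {-1<..<1}"
  shows "N y = 0"
proof (cases "A y + B y = 0")
  case True
  then have "U y = 0" using A_nonneg[of y] B_nonneg[of y] by (simp add: A_def B_def add_nonneg_eq_0_iff)
  then show ?thesis by (simp add: N_def)
next
  case False
  then show ?thesis using W_eq_0[OF assms] by (simp add: W_def)
qed

section \<open>Vanishing of the profile\<close>

text \<open>Without \<open>F\<close> the moduli solve the decoupled equations \<open>(1 + y) * A' = - 2 * a * A\<close> and
  \<open>(1 - y) * B' = 2 * a * B\<close>. Their nonzero solutions blow up at \<open>y = -1\<close> and at \<open>y = 1\<close>,
  respectively.\<close>

lemma profile_eq_0_decoupled:
  assumes y: "y \<in> {-1<..<1}" and F0: "\<And>z. z \<in> {-1<..<1} \<Longrightarrow> F z = 0"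
  shows "U y = 0 \<and> V y = 0"
proof -
  let ?c = "2 * a"
  define f where "f z = A z * (1 + z) powr ?c * (1 - z) powr 0" for z
  define g where "g z = B z * (1 + z) powr 0 * (1 - z) powr ?c" for z
  have f': "(f has_real_derivative 0) (at z)" if z: "z \<in> {-1<..<1}" for z
  proof -
    have "(A has_real_derivative (- 2 * a * A z * (1 - z)) / ((1 + z) * (1 - z))) (at z)"
      using A_deriv[OF z] z by (simp add: F0)
    from weighted_deriv[OF z this, of ?c 0] show ?thesis
      unfolding f_def by simp
  qed
  have g': "(g has_real_derivative 0) (at z)" if z: "z \<in> {-1<..<1}" for z
  proof -
    have "(B has_real_derivative (2 * a * B z * (1 + z)) / ((1 + z) * (1 - z))) (at z)"
      using B_deriv[OF z] z by (simp add: F0)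
    from weighted_deriv[OF z this, of 0 ?c] show ?thesis
      unfolding g_def by simp
  qed
  have "(f \<longlongrightarrow> 0) (at_right (-1))"
    unfolding f_def using a_pos A_bound A_nonneg
    by (intro bounded_times_powr_tendsto_0_at_right_m1[of _ "C\<^sup>2"]) auto
  then have "- f y \<ge> 0"
    using f' by (intro nonneg_if_nondecreasing_tendsto_0_right[OF _ _ _ y, of "\<lambda>z. - f z" "\<lambda>_. 0"])
      (auto intro!: derivative_eq_intros tendsto_eq_intros)
  moreover have "(g \<longlongrightarrow> 0) (at_left 1)"
    unfolding g_def using a_pos B_bound B_nonneg
    by (intro bounded_times_powr_tendsto_0_at_left_1[of _ "C\<^sup>2"]) auto
  then have "g y \<le> 0"
    using g' by (intro nonpos_if_nondecreasing_tendsto_0_left[OF _ _ _ y, of g "\<lambda>_. 0"]) auto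
  moreover have "(1 + y) powr ?c > 0" "(1 - y) powr ?c > 0" using y by auto
  ultimately have "A y \<le> 0" "B y \<le> 0"
    unfolding f_def g_def using y by (auto simp: mult_le_0_iff zero_le_mult_iff)
  then show ?thesis by (simp add: A_def B_def)
qed

text \<open>With \<open>N = 0\<close> the equation for \<open>M\<close> has, besides its scaling term, only the source
  \<open>2 * F * ((1 + y) * A + (1 - y) * B)\<close>. It is nonnegative because \<open>F = (A + B)\<^sup>k\<close>, and zero only
  where \<open>A = B = 0\<close>.\<close>

lemma profile_eq_0_l_eq_1:
  assumes l: "l = 1" and y: "y \<in> {-1<..<1}"
  shows "U y = 0 \<and> V y = 0"
proof -
  define Q where "Q z = 2 * F z * ((1 + z) * A z + (1 - z) * B z)" for z
  define f where "f z = M z * (1 + z) powr a * (1 - z) powr a" for z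
  have f': "(f has_real_derivative Q z * (1 + z) powr (a - 1) * (1 - z) powr (a - 1)) (at z)"
    if z: "z \<in> {-1<..<1}" for z
  proof -
    have "(M has_real_derivative (Q z + 2 * a * z * M z) / ((1 + z) * (1 - z))) (at z)"
      using M_deriv[OF z] N_eq_0[OF _ z] l by (simp add: Q_def)
    from weighted_deriv[OF z this, of a a] show ?thesis
      unfolding f_def by (simp add: algebra_simps)
  qed
  have Q: "Q z * (1 + z) powr (a - 1) * (1 - z) powr (a - 1) \<ge> 0" if "z \<in> {-1<..<1}" for z
    using that A_nonneg[of z] B_nonneg[of z] l unfolding Q_def F_def by simp
  have f0: "f z = 0" if z: "z \<in> {-1<..<1}" for z
  proof (rule antisym)
    show "f z \<le> 0"
      using f' Q
    proof (rule nonpos_if_nondecreasing_tendsto_0_left[OF _ _ _ z])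
      show "(f \<longlongrightarrow> 0) (at_left 1)"
        unfolding f_def using a_pos M_bound
        by (intro bounded_times_powr_tendsto_0_at_left_1[of _ "2 * C\<^sup>2"]) auto
    qed
    show "f z \<ge> 0"
      using f' Q
    proof (rule nonneg_if_nondecreasing_tendsto_0_right[OF _ _ _ z])
      show "(f \<longlongrightarrow> 0) (at_right (-1))"
        unfolding f_def using a_pos M_bound
        by (intro bounded_times_powr_tendsto_0_at_right_m1[of _ "2 * C\<^sup>2"]) auto
    qed
  qed
  have "(f has_real_derivative 0) (at y)"
    using y f0 by (intro has_field_derivative_transform_within_open[OF DERIV_const[of 0], of "{-1<..<1}"]) auto
  then have "Q y * (1 + y) powr (a - 1) * (1 - y) powr (a - 1) = 0"
    using f'[OF y] DERIV_unique by blast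
  then have "(A y + B y) ^ k * ((1 + y) * A y + (1 - y) * B y) = 0"
    using y l unfolding Q_def F_def by simp
  moreover have "(1 + y) * A y \<ge> 0" "(1 - y) * B y \<ge> 0"
    using y A_nonneg[of y] B_nonneg[of y] by auto
  ultimately have "A y = 0 \<and> B y = 0"
    using y A_nonneg[of y] B_nonneg[of y] by (auto simp: add_nonneg_eq_0_iff)
  then show ?thesis by (simp add: A_def B_def)
qed

theorem profile_eq_0:
  assumes y: "y \<in> {-1<..<1}"
  shows "U y = 0 \<and> V y = 0"
proof (cases "l = 1")
  case False
  have "F z = 0" if "z \<in> {-1<..<1}" for z
    using False N_eq_0[OF _ that] unfolding F_def by (cases "l = 0") auto
  then show ?thesis using profile_eq_0_decoupled[OF y] by blast
qed (use profile_eq_0_l_eq_1[OF _ y] in blast)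

end

section \<open>Self-similar solutions\<close>

text \<open>The product rule, evaluated where the independent variables are again conjugates of each
  other.\<close>

lemma dW_cnj1_eq: "dW_cnj1 k l u v = dirac_F k l u v * v + dirac_G k l u v * u"
proof -
  have "((\<lambda>w. dirac_W k l u v w (cnj v)) has_field_derivative
      dirac_F k l u v * v + dirac_G k l u v * u) (at (cnj u))"
    unfolding dirac_W_def
    by (auto intro!: derivative_eq_intros
        simp: dirac_F_def dirac_G_def complex_norm_square mult_ac add_ac simp del: of_real_power)
  then show ?thesis unfolding dW_cnj1_def by (rule DERIV_imp_deriv)
qed

lemma dW_cnj2_eq: "dW_cnj2 k l u v = dirac_F k l u v * u + dirac_G k l u v * v"
proof -
  have "((\<lambda>w. dirac_W k l u v (cnj u) w) has_field_derivative
      dirac_F k l u v * u + dirac_G k l u v * v) (at (cnj v))"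
    unfolding dirac_W_def
    by (auto intro!: derivative_eq_intros
        simp: dirac_F_def dirac_G_def complex_norm_square mult_ac add_ac simp del: of_real_power)
  then show ?thesis unfolding dW_cnj2_def by (rule DERIV_imp_deriv)
qed

lemma self_similar_deriv_t:
  assumes "(U has_vector_derivative U') (at y)"
  shows "((\<lambda>s. self_similar p U y s) has_vector_derivative
      of_real (1 / (2 * real p)) * U y + of_real y * U') (at 0)"
proof -
  have 1: "((\<lambda>s::real. 1 / (1 - s) powr (1 / (2 * real p))) has_real_derivative 1 / (2 * real p)) (at 0)"
    by (auto intro!: derivative_eq_intros)
  have 2: "((\<lambda>s. y / (1 - s)) has_vector_derivative y) (at 0)"
    unfolding has_real_derivative_iff_has_vector_derivative[symmetric]
    by (auto intro!: derivative_eq_intros)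
  have 3: "((\<lambda>s. U (y / (1 - s))) has_vector_derivative y *\<^sub>R U') (at 0)"
    using vector_diff_chain_at[OF 2, of U U'] assms by (simp add: o_def)
  have "((\<lambda>s. (1 / (1 - s) powr (1 / (2 * real p))) *\<^sub>R U (y / (1 - s))) has_vector_derivative
      (1 / (1 - 0) powr (1 / (2 * real p))) *\<^sub>R (y *\<^sub>R U') + (1 / (2 * real p)) *\<^sub>R U (y / (1 - 0))) (at 0)"
    by (rule has_vector_derivative_scaleR[OF 1 3])
  then show ?thesis
    unfolding self_similar_def scaleR_conv_of_real by (simp add: add.commute)
qed

text \<open>At \<open>t = 0\<close> the self-similar fields agree with the profiles, and the time derivatives are
  \<open>U / (2 * p) + y * U'\<close> and \<open>V / (2 * p) + y * V'\<close> by \<open>self_similar_deriv_t\<close>.\<close>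

lemma profile_ode_if_dirac_solution:
  assumes "admissible_profile U" "admissible_profile V"
    and sol: "dirac_solution_on k l light_cone (self_similar p U) (self_similar p V)"
  shows "profile_ode k l p U V"
  unfolding profile_ode_def
proof
  fix y :: real assume y: "y \<in> {-1<..<1}"
  define U' V' where "U' = vector_derivative U (at y)" and "V' = vector_derivative V (at y)"
  have UV: "(U has_vector_derivative U') (at y)" "(V has_vector_derivative V') (at y)"
    using assms(1,2) y vector_derivative_works
    unfolding admissible_profile_def C1_differentiable_on_eq U'_def V'_def by blast+
  have at_0: "self_similar p X z 0 = X z" for X z
    by (simp add: self_similar_def)
  have "(y, 0) \<in> light_cone" using y by (simp add: light_cone_def)
  with sol obtain U1t U1x U2t U2x where *:
        "((\<lambda>s. self_similar p U y s) has_vector_derivative U1t) (at 0)"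
        "((\<lambda>z. self_similar p U z 0) has_vector_derivative U1x) (at y)"
        "((\<lambda>s. self_similar p V y s) has_vector_derivative U2t) (at 0)"
        "((\<lambda>z. self_similar p V z 0) has_vector_derivative U2x) (at y)"
        "\<i> * (U1t + U1x) = dW_cnj1 k l (U y) (V y)"
        "\<i> * (U2t - U2x) = dW_cnj2 k l (U y) (V y)"
    unfolding dirac_solution_on_def by (fastforce simp: at_0)
  have "U1t = of_real (1 / (2 * real p)) * U y + of_real y * U'" "U1x = U'"
    "U2t = of_real (1 / (2 * real p)) * V y + of_real y * V'" "U2x = V'"
    using *(1-4) UV self_similar_deriv_t[OF UV(1), of p] self_similar_deriv_t[OF UV(2), of p]
    by (auto simp: at_0 intro: vector_derivative_unique_at)
  with *(5,6) show "\<i> * (of_real (y + 1) * vector_derivative U (at y) + of_real (1 / (2 * real p)) * U y)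
          = dirac_F k l (U y) (V y) * V y + dirac_G k l (U y) (V y) * U y \<and>
        \<i> * (of_real (y - 1) * vector_derivative V (at y) + of_real (1 / (2 * real p)) * V y)
          = dirac_F k l (U y) (V y) * U y + dirac_G k l (U y) (V y) * V y"
    unfolding dW_cnj1_eq dW_cnj2_eq U'_def[symmetric] V'_def[symmetric]
    by (simp add: algebra_simps)
qed

lemma admissible_profile_bounded:
  assumes "admissible_profile U"
  obtains C where "\<And>y. y \<in> {-1<..<1} \<Longrightarrow> cmod (U y) \<le> C"
proof -
  have "continuous_on {-1<..<1} U"
    using assms C1_differentiable_imp_continuous_on unfolding admissible_profile_def by blast
  moreover obtain C where "AE y in lebesgue_on {-1..1}. cmod (U y) \<le> C"
    using assms unfolding admissible_profile_def L_infinity_on_def by blast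
  ultimately show ?thesis
    using ae_bounded_continuous_imp_bounded that by blast
qed

lemma profile_ode_trivial:
  assumes p: "p > 0"
    and adm: "admissible_profile U" "admissible_profile V" and ode: "profile_ode k l p U V"
    and y: "y \<in> {-1<..<1}"
  shows "U y = 0 \<and> V y = 0"
proof -
  obtain C1 C2 where C: "\<And>y. y \<in> {-1<..<1} \<Longrightarrow> cmod (U y) \<le> C1" "\<And>y. y \<in> {-1<..<1} \<Longrightarrow> cmod (V y) \<le> C2"
    using adm admissible_profile_bounded by metis
  interpret bounded_dirac_profile k l "1 / (2 * real p)" "max C1 C2" U V
    "\<lambda>y. vector_derivative U (at y)" "\<lambda>y. vector_derivative V (at y)"
  proof
    show "(U has_vector_derivative vector_derivative U (at y)) (at y)"
      "(V has_vector_derivative vector_derivative V (at y)) (at y)" if "y \<in> {-1<..<1}" for y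
      using adm that vector_derivative_works
      unfolding admissible_profile_def C1_differentiable_on_eq by blast+
  qed (use p C ode in \<open>auto simp: profile_ode_def le_max_iff_disj\<close>)
  show ?thesis by (rule profile_eq_0[OF y])
qed

theorem theorem1p1:
  fixes k l p :: nat
  assumes "p = k + l - 1" and "p > 0"
  shows "(\<nexists>U V. admissible_profile U \<and> admissible_profile V \<and>
            (\<exists>(x, t) \<in> light_cone. (self_similar p U x t, self_similar p V x t) \<noteq> (0, 0)) \<and>
            dirac_solution_on k l light_cone (self_similar p U) (self_similar p V)) \<and>
         (\<nexists>U V. admissible_profile U \<and> admissible_profile V \<and>
            (\<exists>y \<in> {-1<..<1}. (U y, V y) \<noteq> (0, 0)) \<and>
            profile_ode k l p U V)"
proof (intro conjI notI)
  assume "\<exists>U V. admissible_profile U \<and> admissible_profile V \<and>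
            (\<exists>(x, t) \<in> light_cone. (self_similar p U x t, self_similar p V x t) \<noteq> (0, 0)) \<and>
            dirac_solution_on k l light_cone (self_similar p U) (self_similar p V)"
  then obtain U V x t where UV: "admissible_profile U" "admissible_profile V"
    "dirac_solution_on k l light_cone (self_similar p U) (self_similar p V)"
    and xt: "(x, t) \<in> light_cone" "self_similar p U x t \<noteq> 0 \<or> self_similar p V x t \<noteq> 0"
    by auto
  then have "U (x / (1 - t)) = 0 \<and> V (x / (1 - t)) = 0"
    by (intro profile_ode_trivial[OF assms(2) UV(1,2) profile_ode_if_dirac_solution[OF UV]])
      (simp add: light_cone_def)
  with xt show False by (simp add: self_similar_def)
next
  assume "\<exists>U V. admissible_profile U \<and> admissible_profile V \<and>
            (\<exists>y \<in> {-1<..<1}. (U y, V y) \<noteq> (0, 0)) \<and> profile_ode k l p U V"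
  then show False using profile_ode_trivial[OF assms(2)] by auto
qed

end
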